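(* Let $G$ be a finite connected graph. The following two statements are equivalent. (1) $\overline{\Theta}_G^*$ contains $k>1$ equivalence classes. (2) $G$ is a complete multipartite graph $K_{n_1,\dots,n_\ell}$ with $\ell\in\{3,4\}$. Moreover, in this case, $|\Delta_{ef}|\neq 3$ and $\Delta_{ef}\subseteq\{1,2\}$ hold for all non-adjacent edges $e,f$ of $G$.
   Context: Graphs are simple and undirected, with non-empty vertex set; $d$ is the shortest-path distance in $G$. For edges $e=\{a,b\}$ and $f=\{x,y\}$ (not necessarily distinct), the relation $\Theta_G$ on $E(G)$ is defined by $(e,f)\in\Theta_G$ iff $d(a,x)+d(b,y)\neq d(a,y)+d(b,x)$. The relation $\overline{\Theta}_G$ on $E(G)$ is defined by $(e,f)\in\overline{\Theta}_G$ iff $e=f$, or $e\neq f$ and $(e,f)\notin\Theta_G$. $R^*$ denotes the transitive closure of a reflexive symmetric relation $R$; it is an equivalence relation. $\Delta_{ef}$ is the set $\{d(a,x),d(b,y),d(a,y),d(b,x)\}$. Two edges $e,f$ are adjacent if $e\cap f\neq\emptyset$, and non-adjacent otherwise. The complete multipartite graph $K_{n_1,\dots,n_\ell}$ has vertex set partitioned into $\ell$ sets $V_1,\dots,V_\ell$ with $|V_i|=n_i\geq 1$, and $\{x,y\}$ is an edge iff $x\in V_i$, $y\in V_j$ with $i\neq j$. *)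

theory Defs
  imports "HOL-Library.Disjoint_Sets"
begin

definition simple_graph :: "'a set \<Rightarrow> 'a set set \<Rightarrow> bool" where
  "simple_graph V E \<longleftrightarrow>
     V \<noteq> {} \<and> (\<forall>e\<in>E. \<exists>u v. u \<in> V \<and> v \<in> V \<and> u \<noteq> v \<and> e = {u, v})"

definition is_path :: "'a set \<Rightarrow> 'a set set \<Rightarrow> 'a \<Rightarrow> 'a list \<Rightarrow> 'a \<Rightarrow> bool" where
  "is_path V E u p v \<longleftrightarrow>
     p \<noteq> [] \<and> hd p = u \<and> last p = v \<and> set p \<subseteq> V \<and> distinct p \<and>
     successively (\<lambda>x y. {x, y} \<in> E) p"

definition connected_graph :: "'a set \<Rightarrow> 'a set set \<Rightarrow> bool" where
  "connected_graph V E \<longleftrightarrow> (\<forall>u\<in>V. \<forall>v\<in>V. \<exists>p. is_path V E u p v)"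

text \<open>A path is given by its list of vertices, so its length (number of edges) is one less
  than the length of the list. The value is meaningful only if some path joins the two vertices.\<close>

definition gdist :: "'a set \<Rightarrow> 'a set set \<Rightarrow> 'a \<Rightarrow> 'a \<Rightarrow> nat" where
  "gdist V E u v = (LEAST n. \<exists>p. is_path V E u p v \<and> n = length p - 1)"

text \<open>The choice of names for the end vertices of the two edges does not matter in the next
  definition, see \<open>Theta_iff\<close> below.\<close>

definition Theta :: "'a set \<Rightarrow> 'a set set \<Rightarrow> ('a set \<times> 'a set) set" where
  "Theta V E = {(e, f). e \<in> E \<and> f \<in> E \<and>
     (\<exists>a b x y. e = {a, b} \<and> f = {x, y} \<and>
        gdist V E a x + gdist V E b y \<noteq> gdist V E a y + gdist V E b x)}"

definition Theta_bar :: "'a set \<Rightarrow> 'a set set \<Rightarrow> ('a set \<times> 'a set) set" where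
  "Theta_bar V E = {(e, f). e \<in> E \<and> f \<in> E \<and> (e = f \<or> (e \<noteq> f \<and> (e, f) \<notin> Theta V E))}"

definition Delta :: "'a set \<Rightarrow> 'a set set \<Rightarrow> 'a set \<Rightarrow> 'a set \<Rightarrow> nat set" where
  "Delta V E e f = {gdist V E u v | u v. u \<in> e \<and> v \<in> f}"

definition edges_adjacent :: "'a set \<Rightarrow> 'a set \<Rightarrow> bool" where
  "edges_adjacent e f \<longleftrightarrow> e \<inter> f \<noteq> {}"

text \<open>The list \<open>ns\<close> contains the sizes of the parts, indexed from \<open>0\<close>. All parts are finite,
  since their cardinality is positive.\<close>

definition complete_multipartite :: "nat list \<Rightarrow> 'a set \<Rightarrow> 'a set set \<Rightarrow> bool" where
  "complete_multipartite ns V E \<longleftrightarrow>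
     (\<exists>P :: nat \<Rightarrow> 'a set.
        (\<forall>i<length ns. card (P i) = ns ! i \<and> ns ! i \<ge> 1) \<and>
        disjoint_family_on P {..<length ns} \<and>
        V = (\<Union>i<length ns. P i) \<and>
        E = {{x, y} | x y i j. i < length ns \<and> j < length ns \<and> i \<noteq> j \<and> x \<in> P i \<and> y \<in> P j})"

lemma gdist_commute: "gdist V E u v = gdist V E v u"
proof -
  have rev: "is_path V E y (rev p) x" if "is_path V E x p y" for x y p
    using that by (simp add: is_path_def hd_rev last_rev successively_rev insert_commute)
  have "(\<exists>p. is_path V E u p v \<and> n = length p - 1) \<longleftrightarrow>
        (\<exists>p. is_path V E v p u \<and> n = length p - 1)" for n
    by (metis rev length_rev)
  then show ?thesis
    by (simp add: gdist_def)
qed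

lemma Theta_iff:
  assumes "{a, b} \<in> E" and "{x, y} \<in> E"
  shows "({a, b}, {x, y}) \<in> Theta V E \<longleftrightarrow>
           gdist V E a x + gdist V E b y \<noteq> gdist V E a y + gdist V E b x"
  using assms by (auto simp: Theta_def doubleton_eq_iff)

lemma Delta_eq:
  "Delta V E {a, b} {x, y} = {gdist V E a x, gdist V E b y, gdist V E a y, gdist V E b x}"
  by (auto simp: Delta_def)

lemma sym_Theta: "sym (Theta V E)"
proof (rule symI)
  fix e f assume "(e, f) \<in> Theta V E"
  then obtain a b x y where ef: "e \<in> E" "f \<in> E" "e = {a, b}" "f = {x, y}"
    and "gdist V E a x + gdist V E b y \<noteq> gdist V E a y + gdist V E b x"
    by (auto simp: Theta_def)
  then have "gdist V E x a + gdist V E y b \<noteq> gdist V E x b + gdist V E y a"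
    by (simp add: gdist_commute[of V E a] gdist_commute[of V E b])
  with ef show "(f, e) \<in> Theta V E"
    unfolding Theta_def by blast
qed

lemma equiv_Theta_bar_trancl: "equiv E ((Theta_bar V E)\<^sup>+)"
proof (rule equivI)
  have "Theta_bar V E \<subseteq> E \<times> E"
    by (auto simp: Theta_bar_def)
  then show "(Theta_bar V E)\<^sup>+ \<subseteq> E \<times> E"
    by (rule trancl_subset_Sigma)
  show "refl_on E ((Theta_bar V E)\<^sup>+)"
    by (auto simp: refl_on_def Theta_bar_def)
  have "sym (Theta_bar V E)"
    using sym_Theta[of V E] by (auto simp: sym_def Theta_bar_def)
  then show "sym ((Theta_bar V E)\<^sup>+)"
    by (rule sym_trancl)
qed (rule trans_trancl)

end

(* Call a triangle mixed if its edges do not all lie in one class. Two edges that share a vertex and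
   span an induced path are related, so if every triangle is monochromatic, connectivity leaves at most
   one class. Now let abc be a mixed triangle. A vertex with at most one neighbour on it would force
   its edges into one class, so every vertex misses at most one of a, b, c; replacing a by a vertex
   that misses a yields another mixed triangle. It follows that the vertices missing a, those missing b,
   those missing c and those adjacent to all three are the parts of a complete multipartite graph
   (two adjacent vertices of the last kind would give a K5, all of whose edges are related).
   Conversely, with parts 0, ..., l - 1 for l at most 4, edges whose part pairs share exactly one index
   are never related; so the edges between parts i and j with i div 2 = j div 2 form a union of classes. *)
theory Submission
  imports Defs
begin

locale conn_graph =
  fixes V :: "'a set" and E :: "'a set set"
  assumes simple: "simple_graph V E"
    and conn: "connected_graph V E"
begin

section \<open>Edges, connectivity and the distances 0, 1 and 2\<close>

abbreviation adj :: "'a \<Rightarrow> 'a \<Rightarrow> bool" where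
  "adj x y \<equiv> {x, y} \<in> E"

abbreviation rel :: "'a set \<Rightarrow> 'a set \<Rightarrow> bool" where
  "rel e f \<equiv> (e, f) \<in> (Theta_bar V E)\<^sup>+"

lemma adj_sym: "adj x y \<longleftrightarrow> adj y x"
  by (simp add: insert_commute)

lemma adjD:
  assumes "adj x y" shows "x \<in> V" "y \<in> V" "x \<noteq> y"
  using assms simple unfolding simple_graph_def by (force simp: doubleton_eq_iff)+

lemma not_adj_refl [simp]: "{x} \<notin> E"
  using adjD(3)[of x x] by auto

lemma edgeE:
  assumes "e \<in> E" obtains u v where "e = {u, v}" "u \<in> V" "v \<in> V" "u \<noteq> v"
  using assms simple unfolding simple_graph_def by blast

text \<open>Induction along a path. Connectivity enters in this form: a property passed on by every
  edge spreads from one vertex to all of them.\<close>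

lemma adj_closed_set_eq:
  assumes "u \<in> S" and "v \<in> V" and "u \<in> V"
    and closed: "\<And>x y. x \<in> S \<Longrightarrow> adj x y \<Longrightarrow> y \<in> S"
  shows "v \<in> S"
proof -
  have *: "p \<noteq> [] \<Longrightarrow> hd p \<in> S \<Longrightarrow> successively adj p \<Longrightarrow> last p \<in> S" for p
  proof (induction p rule: induct_list012)
    case (3 x y zs)
    then have "y \<in> S" using closed by auto
    then show ?case using 3 by auto
  qed auto
  obtain p where "is_path V E u p v"
    using conn assms unfolding connected_graph_def by blast
  then show ?thesis
    using * assms(1) unfolding is_path_def by blast
qed

lemma gdist_refl: "x \<in> V \<Longrightarrow> gdist V E x x = 0"
  unfolding gdist_def by (rule Least_eq_0) (rule exI[of _ "[x]"], simp add: is_path_def)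

lemma gdist_adj:
  assumes "adj x y" shows "gdist V E x y = 1"
  unfolding gdist_def
proof (rule Least_equality)
  show "\<exists>p. is_path V E x p y \<and> 1 = length p - 1"
    using assms adjD[OF assms] by (intro exI[of _ "[x, y]"]) (simp add: is_path_def)
  fix n assume "\<exists>p. is_path V E x p y \<and> n = length p - 1"
  then obtain p where p: "is_path V E x p y" "n = length p - 1" by blast
  then show "1 \<le> n"
    using adjD(3)[OF assms] by (cases p; cases "tl p") (auto simp: is_path_def)
qed

lemma gdist_common_nbr:
  assumes "adj x w" and "adj w y" and "x \<noteq> y" and "\<not> adj x y"
  shows "gdist V E x y = 2"
  unfolding gdist_def
proof (rule Least_equality)
  show "\<exists>p. is_path V E x p y \<and> 2 = length p - 1"
    using assms adjD[OF assms(1)] adjD[OF assms(2)]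
    by (intro exI[of _ "[x, w, y]"]) (simp add: is_path_def)
  fix n assume "\<exists>p. is_path V E x p y \<and> n = length p - 1"
  then obtain p where p: "is_path V E x p y" "n = length p - 1" by blast
  then show "2 \<le> n"
    using assms(3,4) by (cases p; cases "tl p"; cases "tl (tl p)") (auto simp: is_path_def)
qed

section \<open>Pairs of edges that are always related\<close>

lemma rel_sym: "rel e f \<Longrightarrow> rel f e"
  using equiv_Theta_bar_trancl[of E V] by (meson equivE symE)

lemma rel_trans: "rel e f \<Longrightarrow> rel f g \<Longrightarrow> rel e g"
  by (rule trancl_trans)

lemma rel_refl: "e \<in> E \<Longrightarrow> rel e e"
  by (auto simp: Theta_bar_def)

lemma rel_I:
  assumes "adj a b" and "adj x y"
    and "gdist V E a x + gdist V E b y = gdist V E a y + gdist V E b x"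
  shows "rel {a, b} {x, y}"
  using assms Theta_iff[OF assms(1,2), of V] by (auto simp: Theta_bar_def intro!: r_into_trancl)

text \<open>The two distance sums are 0 + 2 and 1 + 1.\<close>

lemma rel_induced_path:
  assumes "adj a b" and "adj a c" and "b \<noteq> c" and "\<not> adj b c"
  shows "rel {a, b} {a, c}"
proof (rule rel_I)
  have "adj b a" using assms by (simp add: adj_sym)
  then show "gdist V E a a + gdist V E b c = gdist V E a c + gdist V E b a"
    using assms by (simp add: gdist_refl adjD gdist_adj gdist_common_nbr)
qed (use assms in auto)

text \<open>With \<open>z\<close> attached to the triangle \<open>w a b\<close> at \<open>w\<close>
  alone, both sums for the first pair are 2 + 1; the other two pairs span induced paths.\<close>

lemma rel_pendant:
  assumes "adj z w" and "adj w a" and "adj w b" and "adj a b"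
    and "\<not> adj z a" and "\<not> adj z b"
  shows "rel {z, w} {a, b}" "rel {z, w} {w, a}" "rel {z, w} {w, b}"
proof -
  have ne: "z \<noteq> a" "z \<noteq> b" using assms adj_sym by metis+
  show "rel {z, w} {a, b}"
    using assms ne by (intro rel_I) (simp_all add: gdist_adj gdist_common_nbr[where w = w])
  show "rel {z, w} {w, a}" "rel {z, w} {w, b}"
    using rel_induced_path[of w z] assms ne by (simp_all add: insert_commute)
qed

text \<open>All four distances between opposite edges of a K4 are 1.\<close>

lemma rel_K4:
  assumes "adj a b" and "adj x y" and "adj a x" and "adj a y" and "adj b x" and "adj b y"
  shows "rel {a, b} {x, y}"
  using assms by (intro rel_I) (simp_all add: gdist_adj)

section \<open>Mixed triangles\<close>

definition mixed :: "'a \<Rightarrow> 'a \<Rightarrow> 'a \<Rightarrow> bool" where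
  "mixed a b c \<longleftrightarrow> adj a b \<and> adj b c \<and> adj a c \<and> \<not> (rel {a, b} {a, c} \<and> rel {a, b} {b, c})"

lemma mixedD:
  assumes "mixed a b c"
  shows "adj a b" "adj b c" "adj a c"
  using assms by (auto simp: mixed_def)

lemma mixed_rotate: "mixed a b c \<Longrightarrow> mixed b c a"
  unfolding mixed_def by (auto simp: insert_commute dest: rel_trans rel_sym)

lemma not_mixed:
  assumes "mixed a b c" and "rel e {a, b}" and "rel e {b, c}" and "rel e {a, c}"
  shows False
  using assms rel_sym rel_trans unfolding mixed_def by meson

text \<open>Otherwise \<open>z\<close> is attached to the triangle at \<open>a\<close> alone, and
  \<open>rel_pendant\<close> places all three sides in the class of \<open>{z, a}\<close>.\<close>

lemma mixed_nbr:
  assumes "mixed a b c" and "adj z a"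
  shows "adj z b \<or> adj z c"
proof (rule ccontr)
  assume "\<not> (adj z b \<or> adj z c)"
  then have "rel {z, a} {b, c}" "rel {z, a} {a, b}" "rel {z, a} {a, c}"
    using rel_pendant[of z a b c] assms mixedD by blast+
  then show False using not_mixed assms(1) by blast
qed

text \<open>If \<open>z\<close> misses the triangle, \<open>{z, w}\<close> is related to
  \<open>{a, b}\<close>, \<open>{w, a}\<close> and \<open>{w, b}\<close>. The sides at
  \<open>c\<close> follow from the triangles \<open>w b c\<close> and \<open>w a c\<close> if
  \<open>w\<close> is adjacent to \<open>c\<close>, and from the induced paths \<open>w a c\<close>
  and \<open>w b c\<close> if not.\<close>

lemma mixed_no_far:
  assumes "mixed a b c" and "adj w a" and "adj w b" and "adj z w"
  shows "adj z a \<or> adj z b \<or> adj z c"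
proof (rule ccontr)
  assume neg: "\<not> ?thesis"
  note m = mixedD[OF assms(1)]
  have r: "rel {z, w} {a, b}" "rel {z, w} {w, a}" "rel {z, w} {w, b}"
    using rel_pendant[of z w a b] assms m neg by blast+
  show False
  proof (cases "adj w c")
    case True
    then have "rel {z, w} {b, c}" "rel {z, w} {a, c}"
      using rel_pendant[of z w] assms m neg by blast+
    then show False using r not_mixed assms(1) by blast
  next
    case False
    have "w \<noteq> c" using assms neg by blast
    then have "rel {w, a} {a, c}" "rel {w, b} {b, c}"
      using False rel_induced_path[of _ w c] assms m by (simp_all add: insert_commute)
    then show False using r not_mixed assms(1) rel_trans by meson
  qed
qed

text \<open>The corners of a triangle qualify too, each missing only itself, so the spreading
  argument below can start at \<open>a\<close>.\<close>

definition two_nbrs :: "'a \<Rightarrow> 'a \<Rightarrow> 'a \<Rightarrow> 'a \<Rightarrow> bool" where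
  "two_nbrs a b c z \<longleftrightarrow>
     (adj z a \<or> adj z b) \<and> (adj z b \<or> adj z c) \<and> (adj z a \<or> adj z c)"

text \<open>As \<open>w\<close> sees two corners, \<open>mixed_no_far\<close> for the matching
  rotation of the triangle gives \<open>z\<close> one corner, and \<open>mixed_nbr\<close> a
  second.\<close>

lemma mixed_two_nbrs_step:
  assumes m: "mixed a b c" and w: "two_nbrs a b c w" and zw: "adj w z"
  shows "two_nbrs a b c z"
proof -
  have m': "mixed b c a" "mixed c a b" using m mixed_rotate by blast+
  have zw': "adj z w" using zw by (simp add: adj_sym)
  have "adj z a \<or> adj z b \<or> adj z c"
    using w mixed_no_far[OF m _ _ zw'] mixed_no_far[OF m'(1) _ _ zw']
      mixed_no_far[OF m'(2) _ _ zw'] unfolding two_nbrs_def by blast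
  then show ?thesis
    using mixed_nbr[OF m, of z] mixed_nbr[OF m'(1), of z] mixed_nbr[OF m'(2), of z]
    unfolding two_nbrs_def by blast
qed

lemma mixed_two_nbrs:
  assumes m: "mixed a b c" and "z \<in> V"
  shows "two_nbrs a b c z"
proof -
  have "two_nbrs a b c a"
    using mixedD[OF m] by (auto simp: two_nbrs_def)
  then have a: "a \<in> Collect (two_nbrs a b c)" by simp
  have "y \<in> Collect (two_nbrs a b c)" if "x \<in> Collect (two_nbrs a b c)" "adj x y" for x y
    using mixed_two_nbrs_step[OF m] that by simp
  from adj_closed_set_eq[OF a \<open>z \<in> V\<close> adjD(1)[OF mixedD(1)[OF m]] this]
  show ?thesis by simp
qed

text \<open>For \<open>x\<close> other than \<open>a\<close>, the paths \<open>x b a\<close> and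
  \<open>x c a\<close> are induced, so each new side keeps the class of the side it
  replaces.\<close>

lemma mixed_replace:
  assumes m: "mixed a b c" and "x \<in> V" and "\<not> adj x a"
  shows "mixed x b c"
proof (cases "x = a")
  case False
  have adj: "adj x b" "adj x c"
    using mixed_two_nbrs[OF m \<open>x \<in> V\<close>] assms(3) by (auto simp: two_nbrs_def)
  have "rel {x, b} {a, b}" "rel {x, c} {a, c}"
    using rel_induced_path[of b x a] rel_induced_path[of c x a] adj mixedD[OF m] False assms(3)
    by (simp_all add: insert_commute)
  then show ?thesis
    using m adj rel_sym rel_trans unfolding mixed_def by meson
qed (use m in simp)

text \<open>Both vertices see \<open>b\<close> and \<open>c\<close>. If they were adjacent,
  attaching \<open>a\<close> to the triangles \<open>b x y\<close> and \<open>c x y\<close> would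
  relate \<open>{x, y}\<close> to \<open>{a, b}\<close> and \<open>{a, c}\<close>, and the K4 on
  \<open>b c x y\<close> would relate it to \<open>{b, c}\<close>.\<close>

lemma mixed_part_indep:
  assumes m: "mixed a b c" and "x \<in> V" and "y \<in> V" and "\<not> adj x a" and "\<not> adj y a"
  shows "\<not> adj x y"
proof
  assume xy: "adj x y"
  note m' = mixedD[OF m]
  have n: "\<not> adj a x" "\<not> adj a y" using assms by (simp_all add: adj_sym)
  have adj: "adj x b" "adj x c" "adj y b" "adj y c"
    using mixed_two_nbrs[OF m] assms by (auto simp: two_nbrs_def)
  then have adj': "adj b x" "adj c x" "adj b y" "adj c y" by (simp_all add: adj_sym)
  have "rel {a, b} {x, y}" "rel {a, c} {x, y}"
    using rel_pendant(1)[of a _ x y] m' n adj' xy by blast+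
  moreover have "rel {x, y} {b, c}"
    using rel_K4[of x y b c] adj xy m' by blast
  ultimately show False
    using not_mixed[OF m] rel_sym by blast
qed

lemma mixed_same_missing:
  assumes m: "mixed a b c" and "x \<in> V" and "y \<in> V" and "\<not> adj x a"
  shows "adj x y \<longleftrightarrow> adj y a"
proof
  assume "adj x y" then show "adj y a" using mixed_part_indep assms by blast
next
  assume ya: "adj y a"
  show "adj x y"
  proof (rule ccontr)
    assume "\<not> adj x y"
    \<comment> \<open>In the mixed triangle \<open>x b c\<close>, both \<open>y\<close> and
      \<open>a\<close> miss the corner \<open>x\<close>.\<close>
    then have "\<not> adj y a"
      using mixed_part_indep[OF mixed_replace[OF m \<open>x \<in> V\<close> \<open>\<not> adj x a\<close>], of y a] assms
        adjD(2)[OF ya] by (simp add: adj_sym)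
    then show False using ya by simp
  qed
qed

text \<open>Disjoint edges of a K5 are opposite in a K4. Such steps lead from \<open>{a, b}\<close>
  over \<open>{c, x}\<close> and \<open>{a, y}\<close> to \<open>{b, c}\<close>, and over
  \<open>{c, x}\<close> and \<open>{b, y}\<close> to \<open>{a, c}\<close>.\<close>

lemma mixed_no_K5:
  assumes m: "mixed a b c" and "adj x a" "adj x b" "adj x c" "adj y a" "adj y b" "adj y c"
  shows "\<not> adj x y"
proof
  assume xy: "adj x y"
  have s: "adj u v \<Longrightarrow> adj v u" for u v by (simp add: adj_sym)
  note as = mixedD[OF m] assms(2-) xy
  have r: "rel {a, b} {c, x}" using rel_K4 as s by metis
  have "rel {c, x} {a, y}" "rel {a, y} {b, c}" "rel {c, x} {b, y}" "rel {b, y} {a, c}"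
    using rel_K4 as s by metis+
  with r have "rel {a, b} {b, c}" "rel {a, b} {a, c}" by (meson rel_trans)+
  then show False using m by (simp add: mixed_def)
qed

section \<open>The colouring read off a mixed triangle\<close>

definition part_index :: "'a \<Rightarrow> 'a \<Rightarrow> 'a \<Rightarrow> 'a \<Rightarrow> nat" where
  "part_index a b c z =
     (if \<not> adj z a then 0 else if \<not> adj z b then 1 else if \<not> adj z c then 2 else 3)"

text \<open>No vertex misses two corners, so the order of the tests in \<open>part_index\<close> is
  immaterial. If \<open>x\<close> or \<open>y\<close> misses a corner,
  \<open>mixed_same_missing\<close> decides; if both see all corners, they share index 3 and
  \<open>mixed_no_K5\<close> excludes an edge.\<close>

lemma adj_iff_part_index:
  assumes m: "mixed a b c" and "x \<in> V" and "y \<in> V"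
  shows "adj x y \<longleftrightarrow> part_index a b c x \<noteq> part_index a b c y"
proof -
  have m': "mixed b c a" "mixed c a b" using m mixed_rotate by blast+
  have "\<not> adj x a \<Longrightarrow> adj x y \<longleftrightarrow> adj y a" "\<not> adj y a \<Longrightarrow> adj x y \<longleftrightarrow> adj x a"
    "\<not> adj x b \<Longrightarrow> adj x y \<longleftrightarrow> adj y b" "\<not> adj y b \<Longrightarrow> adj x y \<longleftrightarrow> adj x b"
    "\<not> adj x c \<Longrightarrow> adj x y \<longleftrightarrow> adj y c" "\<not> adj y c \<Longrightarrow> adj x y \<longleftrightarrow> adj x c"
    using mixed_same_missing[OF m, of x y] mixed_same_missing[OF m, of y x]
      mixed_same_missing[OF m'(1), of x y] mixed_same_missing[OF m'(1), of y x]
      mixed_same_missing[OF m'(2), of x y] mixed_same_missing[OF m'(2), of y x]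
      assms adj_sym[of x y] by blast+
  then show ?thesis
    using mixed_two_nbrs[OF m \<open>x \<in> V\<close>] mixed_two_nbrs[OF m \<open>y \<in> V\<close>] mixed_no_K5[OF m, of x y]
    unfolding part_index_def two_nbrs_def by (cases "adj x y") auto
qed

text \<open>The corners have the indices 0, 1 and 2; whether some vertex sees all three decides
  between three and four parts.\<close>

lemma part_index_image:
  assumes m: "mixed a b c"
  shows "\<exists>l\<in>{3, 4}. part_index a b c ` V = {..<l}"
proof -
  have sets: "{..<3} = {0, 1, 2 :: nat}" "{..<4} = insert 3 {0, 1, 2 :: nat}" by auto
  note as = mixedD[OF m]
  have "part_index a b c a = 0" "part_index a b c b = 1" "part_index a b c c = 2"
    using as by (simp_all add: part_index_def insert_commute)
  moreover have "a \<in> V" "b \<in> V" "c \<in> V" using as adjD by blast+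
  ultimately have "{0, 1, 2} \<subseteq> part_index a b c ` V" by (metis empty_subsetI image_eqI insert_subset)
  moreover have "part_index a b c ` V \<subseteq> insert 3 {0, 1, 2}"
    by (auto simp: part_index_def)
  ultimately have "part_index a b c ` V = {0, 1, 2} \<or> part_index a b c ` V = insert 3 {0, 1, 2}"
    by (metis insert_absorb insert_subset subset_antisym subset_insert)
  then show ?thesis by (elim disjE) (simp_all add: sets)
qed

section \<open>Graphs without mixed triangles\<close>

lemma all_rel_if_no_mixed:
  assumes nm: "\<And>a b c. \<not> mixed a b c" and "e \<in> E" and "f \<in> E"
  shows "rel e f"
proof -
  \<comment> \<open>Two edges at a vertex coincide, span an induced path, or lie in a triangle that
    is not mixed.\<close>
  have step: "rel {a, b} {a, c}" if "adj a b" "adj a c" for a b c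
    using that rel_induced_path[of a b c] nm[of a b c] rel_refl unfolding mixed_def by blast
  obtain u v where e: "e = {u, v}" "u \<in> V" using edgeE[OF \<open>e \<in> E\<close>] by metis
  obtain x y where f: "f = {x, y}" "x \<in> V" using edgeE[OF \<open>f \<in> E\<close>] by metis
  \<comment> \<open>An edge at a vertex of this set carries the class of \<open>e\<close> to all
    edges at its other end.\<close>
  have "x \<in> {x. \<forall>y. adj x y \<longrightarrow> rel e {x, y}}"
  proof (rule adj_closed_set_eq[of u])
    show "u \<in> {x. \<forall>y. adj x y \<longrightarrow> rel e {x, y}}"
      using step e \<open>e \<in> E\<close> by blast
    fix x y assume x: "x \<in> {x. \<forall>y. adj x y \<longrightarrow> rel e {x, y}}" and xy: "adj x y"
    then have "rel e {y, x}" "adj y x" by (auto simp: insert_commute)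
    then show "y \<in> {x. \<forall>y. adj x y \<longrightarrow> rel e {x, y}}"
      using step rel_trans by blast
  qed (use e f in auto)
  then show ?thesis using f \<open>f \<in> E\<close> by blast
qed

section \<open>Families of parts and colourings\<close>

lemma complete_multipartite_iff_coloring:
  assumes "finite V"
  shows "(\<exists>ns. length ns = l \<and> complete_multipartite ns V E) \<longleftrightarrow>
         (\<exists>h :: 'a \<Rightarrow> nat. h ` V = {..<l} \<and> (\<forall>x\<in>V. \<forall>y\<in>V. adj x y \<longleftrightarrow> h x \<noteq> h y))"
    (is "?L \<longleftrightarrow> ?R")
proof
  assume ?L
  then obtain ns and P :: "nat \<Rightarrow> 'a set" where l: "length ns = l"
    and card: "\<And>i. i < l \<Longrightarrow> card (P i) = ns ! i \<and> ns ! i \<ge> 1"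
    and disj: "disjoint_family_on P {..<l}" and V: "V = (\<Union>i<l. P i)"
    and E: "E = {{x, y} | x y i j. i < l \<and> j < l \<and> i \<noteq> j \<and> x \<in> P i \<and> y \<in> P j}"
    unfolding complete_multipartite_def by auto
  \<comment> \<open>Disjointness of the parts makes this index unique.\<close>
  define h where "h x = (THE i. i < l \<and> x \<in> P i)" for x
  have h: "h x = i" if "i < l" "x \<in> P i" for x i
    unfolding h_def using that disj
    by (intro the_equality) (auto simp: disjoint_family_on_def)
  have hV: "h x < l \<and> x \<in> P (h x)" if "x \<in> V" for x
    using that h V by auto
  have "i \<in> h ` V" if "i < l" for i
  proof -
    have "P i \<noteq> {}" using card[OF that] by (metis card.empty not_one_le_zero)
    then obtain x where "x \<in> P i" by blast
    then show ?thesis using h[OF that] V that by blast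
  qed
  then have "h ` V = {..<l}" using hV by auto
  moreover have "adj x y \<longleftrightarrow> h x \<noteq> h y" if "x \<in> V" "y \<in> V" for x y
  proof
    assume "adj x y"
    then obtain u v i j where "{x, y} = {u, v}" "i < l" "j < l" "i \<noteq> j" "u \<in> P i" "v \<in> P j"
      using E by blast
    then show "h x \<noteq> h y" using h by (metis doubleton_eq_iff)
  next
    assume "h x \<noteq> h y" then show "adj x y" using hV that E by blast
  qed
  ultimately show ?R by blast
next
  assume ?R
  then obtain h :: "'a \<Rightarrow> nat" where h: "h ` V = {..<l}"
    and adj: "\<And>x y. x \<in> V \<Longrightarrow> y \<in> V \<Longrightarrow> adj x y \<longleftrightarrow> h x \<noteq> h y" by metis
  define P where "P i = {x \<in> V. h x = i}" for i
  define ns where "ns = map (\<lambda>i. card (P i)) [0..<l]"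
  have l: "length ns = l" by (simp add: ns_def)
  have "card (P i) = ns ! i \<and> ns ! i \<ge> 1" if "i < l" for i
  proof -
    have "i \<in> h ` V" using that h by simp
    then have "P i \<noteq> {}" unfolding P_def by blast
    \<comment> \<open>Since \<open>card\<close> is 0 on infinite sets, finiteness of
      \<open>V\<close> is what makes the size of a non-empty part positive.\<close>
    then show ?thesis using that assms by (simp add: ns_def P_def Suc_le_eq card_gt_0_iff)
  qed
  moreover have "disjoint_family_on P {..<l}" by (auto simp: disjoint_family_on_def P_def)
  moreover have "V = (\<Union>i<l. P i)" using h by (auto simp: P_def)
  moreover have "E = {{x, y} | x y i j. i < l \<and> j < l \<and> i \<noteq> j \<and> x \<in> P i \<and> y \<in> P j}" (is "_ = ?F")
  proof (intro set_eqI iffI)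
    fix e assume "e \<in> E"
    then obtain u v where e: "e = {u, v}" "u \<in> V" "v \<in> V" using edgeE by metis
    then have "h u \<noteq> h v" using adj \<open>e \<in> E\<close> by blast
    moreover have "h u < l" "h v < l" using h e by blast+
    ultimately show "e \<in> ?F" using e unfolding P_def by blast
  qed (auto simp: P_def adj)
  ultimately have "complete_multipartite ns V E"
    unfolding complete_multipartite_def l by (intro exI[of _ P]) simp
  then show ?L using l by blast
qed

end

section \<open>Colourings with three or four colours\<close>

locale colored_graph = conn_graph +
  fixes l :: nat and h :: "'a \<Rightarrow> nat"
  assumes l: "l \<in> {3, 4}"
    and image: "h ` V = {..<l}"
    and adj_iff: "x \<in> V \<Longrightarrow> y \<in> V \<Longrightarrow> adj x y \<longleftrightarrow> h x \<noteq> h y"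
begin

lemma gdist_eq:
  assumes "u \<in> V" and "v \<in> V"
  shows "gdist V E u v = (if u = v then 0 else if h u = h v then 2 else 1)"
proof -
  \<comment> \<open>A vertex outside the part of \<open>u\<close> is a common neighbour of any two
    vertices of that part; one exists because the colours 0 and 1 both occur.\<close>
  have "\<exists>w\<in>V. h w \<noteq> h u"
  proof (cases "h u = 0")
    case True
    have "1 \<in> h ` V" using image l by auto
    then show ?thesis using True by force
  next
    case False
    have "0 \<in> h ` V" using image l by auto
    then show ?thesis using False by force
  qed
  then obtain w where w: "w \<in> V" "h w \<noteq> h u" by blast
  then show ?thesis
    using assms gdist_refl gdist_adj[of u v] gdist_common_nbr[of u w v] adj_iff by auto
qed

text \<open>\<open>div 2\<close> groups the colours into {0, 1} and {2, 3}. Related edges have equal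
  or disjoint colour pairs, and with at most four colours the only pair disjoint from one group is
  the other.\<close>

lemma Theta_bar_h_div_2:
  assumes "({a, b}, {x, y}) \<in> Theta_bar V E" and "h a div 2 = h b div 2"
  shows "h x div 2 = h y div 2"
proof -
  have ed: "adj a b" "adj x y" using assms by (auto simp: Theta_bar_def)
  note V = adjD(1,2)[OF ed(1)] adjD(1,2)[OF ed(2)]
  have lt: "h z = 0 \<or> h z = 1 \<or> h z = 2 \<or> h z = 3" if "z \<in> V" for z
  proof -
    have "h z \<in> {..<l}" using image that by blast
    then show ?thesis using l by auto
  qed
  have ne: "h a \<noteq> h b" "h x \<noteq> h y" using ed V adj_iff by blast+
  show ?thesis
  proof (cases "{a, b} = {x, y}")
    case True
    then show ?thesis using assms(2) by (auto simp: doubleton_eq_iff)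
  next
    case False
    then have "gdist V E a x + gdist V E b y = gdist V E a y + gdist V E b x"
      using assms(1) Theta_iff[OF ed, of V] by (auto simp: Theta_bar_def)
    \<comment> \<open>With exactly one shared colour, the sum containing the shared pair would be 0
      + 1 or 2 + 1, the other 1 + 1.\<close>
    then have "h a = h x \<longleftrightarrow> h b = h y" "h a = h y \<longleftrightarrow> h b = h x"
      using V ne by (auto simp: gdist_eq split: if_splits)
    then show ?thesis
      using ne assms(2) lt[OF V(1)] lt[OF V(2)] lt[OF V(3)] lt[OF V(4)]
      by (elim disjE) simp_all
  qed
qed

lemma rel_h_div_2:
  assumes "rel e f" and "\<And>a b. e = {a, b} \<Longrightarrow> h a div 2 = h b div 2"
  shows "f = {x, y} \<Longrightarrow> h x div 2 = h y div 2"
  using assms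
proof (induction arbitrary: x y rule: trancl_induct)
  case (base f)
  then have "e \<in> E" by (simp add: Theta_bar_def)
  then obtain a b where "e = {a, b}" by (rule edgeE)
  then show ?case using base Theta_bar_h_div_2 by blast
next
  case (step f g)
  have "f \<in> E" using step.hyps(2) by (simp add: Theta_bar_def)
  then obtain a b where f: "f = {a, b}" by (rule edgeE)
  then have "h a div 2 = h b div 2" using step.IH step.prems(2) by blast
  then show ?case using step.hyps(2) step.prems(1) f Theta_bar_h_div_2 by blast
qed

text \<open>Colours 0 and 1 belong to one group, 0 and 2 do not, so edges of these two types lie in
  different classes.\<close>

lemma ex_not_rel: "\<exists>e\<in>E. \<exists>f\<in>E. \<not> rel e f"
proof -
  have "0 \<in> h ` V" "1 \<in> h ` V" "2 \<in> h ` V" using image l by auto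
  then obtain a b c where abc: "a \<in> V" "b \<in> V" "c \<in> V" "h a = 0" "h b = 1" "h c = 2"
    by (metis imageE)
  have "h u div 2 = h v div 2" if "{a, b} = {u, v}" for u v
    using that abc by (auto simp: doubleton_eq_iff)
  then have "\<not> rel {a, b} {a, c}"
    using rel_h_div_2[of "{a, b}" "{a, c}" a c] abc by auto
  moreover have "adj a b" "adj a c" using abc adj_iff by auto
  ultimately show ?thesis by blast
qed

text \<open>Without a common vertex the distance 0 cannot occur, and no distance exceeds 2 by
  \<open>gdist_eq\<close>.\<close>

lemma Delta_subset:
  assumes "e \<in> E" and "f \<in> E" and "\<not> edges_adjacent e f"
  shows "Delta V E e f \<subseteq> {1, 2}"
proof -
  have "e \<subseteq> V" "f \<subseteq> V" using assms edgeE by blast+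
  then have "gdist V E u v \<in> {1, 2}" if "u \<in> e" "v \<in> f" for u v
  proof -
    have "u \<in> V" "v \<in> V" "u \<noteq> v"
      using that \<open>e \<subseteq> V\<close> \<open>f \<subseteq> V\<close> assms(3) by (auto simp: edges_adjacent_def)
    then show ?thesis by (simp add: gdist_eq)
  qed
  then show ?thesis unfolding Delta_def by blast
qed

end

section \<open>Counting classes and the equivalence\<close>

lemma card_quotient_gt_1_iff:
  assumes "equiv A r" and "finite A"
  shows "card (A // r) > 1 \<longleftrightarrow> (\<exists>x\<in>A. \<exists>y\<in>A. (x, y) \<notin> r)"
proof -
  have "finite (A // r)"
    using assms by (intro finite_quotient) (auto elim: equivE)
  then have "card (A // r) > 1 \<longleftrightarrow> (\<exists>X\<in>A // r. \<exists>Y\<in>A // r. X \<noteq> Y)"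
    by (auto simp: card_le_Suc0_iff_eq simp flip: not_le)
  also have "\<dots> \<longleftrightarrow> (\<exists>x\<in>A. \<exists>y\<in>A. (x, y) \<notin> r)"
    unfolding quotient_def using eq_equiv_class_iff[OF assms(1)] by auto
  finally show ?thesis .
qed

theorem theorem3p13:
  fixes V :: "'a set" and E :: "'a set set"
  assumes "simple_graph V E"
    and "finite V"
    and "connected_graph V E"
  shows "(card (E // (Theta_bar V E)\<^sup>+) > 1 \<longleftrightarrow>
            (\<exists>ns. length ns \<in> {3, 4} \<and> complete_multipartite ns V E)) \<and>
         (card (E // (Theta_bar V E)\<^sup>+) > 1 \<longrightarrow>
            (\<forall>e\<in>E. \<forall>f\<in>E. \<not> edges_adjacent e f \<longrightarrow>
               card (Delta V E e f) \<noteq> 3 \<and> Delta V E e f \<subseteq> {1, 2}))"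
proof -
  interpret conn_graph V E using assms by unfold_locales
  have "E \<subseteq> Pow V" using edgeE by blast
  then have "finite E" using \<open>finite V\<close> by (meson finite_Pow_iff finite_subset)
  then have classes: "card (E // (Theta_bar V E)\<^sup>+) > 1 \<longleftrightarrow> (\<exists>e\<in>E. \<exists>f\<in>E. \<not> rel e f)"
    by (intro card_quotient_gt_1_iff equiv_Theta_bar_trancl)
  have multi: "(\<exists>ns. length ns \<in> {3, 4} \<and> complete_multipartite ns V E) \<longleftrightarrow>
      (\<exists>l h. colored_graph V E l h)"
  proof -
    have "colored_graph V E l h \<longleftrightarrow> l \<in> {3, 4} \<and> h ` V = {..<l} \<and>
        (\<forall>x\<in>V. \<forall>y\<in>V. adj x y \<longleftrightarrow> h x \<noteq> h y)" for l and h :: "'a \<Rightarrow> nat"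
      unfolding colored_graph_def colored_graph_axioms_def using conn_graph_axioms by blast
    then have "(\<exists>h. colored_graph V E l h) \<longleftrightarrow>
        l \<in> {3, 4} \<and> (\<exists>ns. length ns = l \<and> complete_multipartite ns V E)" for l
      unfolding complete_multipartite_iff_coloring[OF \<open>finite V\<close>] by simp
    then show ?thesis by auto
  qed
  have "\<exists>l h. colored_graph V E l h" if "\<exists>e\<in>E. \<exists>f\<in>E. \<not> rel e f"
  proof -
    have "\<exists>a b c. mixed a b c" using that all_rel_if_no_mixed by blast
    then obtain a b c where m: "mixed a b c" by blast
    obtain l where "l \<in> {3, 4}" "part_index a b c ` V = {..<l}"
      using part_index_image[OF m] by (elim bexE)
    then have "colored_graph V E l (part_index a b c)"
      using adj_iff_part_index[OF m] by unfold_locales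
    then show ?thesis by blast
  qed
  moreover have "\<exists>e\<in>E. \<exists>f\<in>E. \<not> rel e f" if "colored_graph V E l h" for l h
    using colored_graph.ex_not_rel[OF that] .
  moreover have "card (Delta V E e f) \<noteq> 3 \<and> Delta V E e f \<subseteq> {1, 2}"
    if "colored_graph V E l h" "e \<in> E" "f \<in> E" "\<not> edges_adjacent e f" for l h e f
  proof -
    have D: "Delta V E e f \<subseteq> {1, 2}" using colored_graph.Delta_subset that by blast
    \<comment> \<open>At most two values remain, which excludes the cardinality 3.\<close>
    then have "card (Delta V E e f) \<le> card {1, 2 :: nat}" by (intro card_mono) auto
    then show ?thesis using D by simp
  qed
  ultimately show ?thesis unfolding classes multi by blast
qed

end
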